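(* Let $G$ be an oriented graph (possibly with parallel arcs) of maximum degree $\Delta$ with maximum out-degree at most $d$. Let $C$ be a set of $k$ colors, and let each arc $e\in A(G)$ have an associated conflict $f(e)\in C^2$. If the restrictiveness of $f$ is at most $r$ and \[k \geq \sqrt{d}\cdot 2^{r/2+2}\sqrt{r}\sqrt{1+\log((d+1)\Delta)},\] then $G$ has a single-conflict coloring with respect to $f$ and $C$.
   Context: An oriented graph here is a loopless directed multigraph; $A(G)$ is its arc set, $A^+(v)$ the set of arcs leaving $v$; two arcs are parallel if they join the same pair of vertices. For an arc $e=(u,v)$ with conflict $f(e)=(c_1,c_2)$, the first entry corresponds to $u$ and the second to $v$. A coloring $\phi:V(G)\to C$ is a single-conflict coloring with respect to $f$ and $C$ if $(\phi(u),\phi(v))\neq f(e)$ for every arc $e=(u,v)$. Parallel arcs may be assumed to carry distinct conflicts. The restrictiveness of $f$ at a vertex $v$ is the maximum $r_v$ such that there exist $r_v$ parallel arcs in $A^+(v)$ whose conflicts form a set $\{(c_1,c^* ),(c_2,c^* ),\dots,(c_{r_v},c^* )\}$, where the first entry corresponds to $v$, $c^*\in C$ is a single color, and $c_1,\dots,c_{r_v}$ are distinct colors; the restrictiveness of $f$ is the maximum of $r_v$ over all $v\in V(G)$. The degree of a vertex counts all incident arcs. $\log$ is the natural logarithm. *)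

theory Defs
  imports
    Complex_Main
    "HOL-Library.Extended_Nat"
    "HOL-Library.FuncSet"
    "Graph_Theory.Digraph"
begin

text \<open>
  An oriented graph is a \<^locale>\<open>loopfree_digraph\<close>, which admits parallel arcs. Finiteness is
  not required: degrees and their suprema are taken in \<^typ>\<open>enat\<close>, so that having maximum degree
  \<^term>\<open>enat D\<close> entails that every vertex has at most \<open>D\<close> incident arcs, whereas the
  library's \<^typ>\<open>nat\<close>-valued degrees are \<open>0\<close> at vertices with infinitely many arcs.
\<close>

definition ecard :: "'a set \<Rightarrow> enat" where
  "ecard A = (if finite A then enat (card A) else \<infinity>)"

text \<open>In a digraph without loops the arcs entering and the arcs leaving \<open>v\<close> are disjoint.\<close>

definition max_degree :: "('v, 'e) pre_digraph \<Rightarrow> enat" where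
  "max_degree G = (SUP v \<in> verts G. ecard (in_arcs G v \<union> out_arcs G v))"

definition max_out_degree :: "('v, 'e) pre_digraph \<Rightarrow> enat" where
  "max_out_degree G = (SUP v \<in> verts G. ecard (out_arcs G v))"

definition parallel_arcs :: "('v, 'e) pre_digraph \<Rightarrow> 'e \<Rightarrow> 'e \<Rightarrow> bool" where
  "parallel_arcs G e e' \<longleftrightarrow> {tail G e, head G e} = {tail G e', head G e'}"

text \<open>
  The first entry of \<open>f e\<close> corresponds to the tail of \<open>e\<close>, the second one to its head.
  Hence for \<open>e\<close> in \<^term>\<open>out_arcs G v\<close> the first entry is the one at \<open>v\<close>.
  The case \<open>P = {}\<close> makes the restrictiveness \<open>0\<close> at vertices without leaving arcs.
\<close>

definition restrictiveness_at ::
    "('v, 'e) pre_digraph \<Rightarrow> ('e \<Rightarrow> 'c \<times> 'c) \<Rightarrow> 'v \<Rightarrow> enat" where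
  "restrictiveness_at G f v = Sup {enat n | n. \<exists>P S c.
     P \<subseteq> out_arcs G v \<and> finite P \<and> card P = n \<and>
     (\<forall>e\<in>P. \<forall>e'\<in>P. parallel_arcs G e e') \<and>
     finite S \<and> card S = n \<and> f ` P = S \<times> {c}}"

definition restrictiveness :: "('v, 'e) pre_digraph \<Rightarrow> ('e \<Rightarrow> 'c \<times> 'c) \<Rightarrow> enat" where
  "restrictiveness G f = (SUP v \<in> verts G. restrictiveness_at G f v)"

definition single_conflict_coloring ::
    "('v, 'e) pre_digraph \<Rightarrow> ('e \<Rightarrow> 'c \<times> 'c) \<Rightarrow> 'c set \<Rightarrow> ('v \<Rightarrow> 'c) \<Rightarrow> bool" where
  "single_conflict_coloring G f C \<phi> \<longleftrightarrow>
     \<phi> \<in> verts G \<rightarrow> C \<and> (\<forall>e\<in>arcs G. (\<phi> (tail G e), \<phi> (head G e)) \<noteq> f e)"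

end

theory Submission
  imports Defs "HOL-Probability.Product_PMF"
begin

text \<open>
  Give every vertex \<open>v\<close> a random set \<open>S v\<close> of colors, each color being chosen independently with
  probability \<open>p = k / (4 d r)\<close>. If every \<open>S v\<close> contains a color \<open>c\<close> such that no arc \<open>e\<close> from \<open>v\<close>
  to some \<open>w\<close> has a conflict \<open>(c, c')\<close> with \<open>c' \<in> S w\<close>, then coloring each \<open>v\<close> by such a color
  violates no conflict. The number of colors that \<open>v\<close> loses because of its outneighbors is a sum of
  independent variables, one for each pair \<open>(w, c')\<close>, bounded by \<open>r\<close> and of total weight at most
  \<open>d\<close>; its exponential moment bounds the failure probability of \<open>v\<close> by
  \<open>exp (2 p\<^sup>2 d - p k)\<close>, and the local lemma yields a coloring of every finite set of vertices. A
  compactness argument extends this to infinite graphs. The bound needs \<open>p \<le> 1 / r\<close>, which holds when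
  \<open>k \<le> d\<close>; if \<open>k > d\<close>, every vertex has a color that is the first entry of no conflict on its
  outgoing arcs.
\<close>

section \<open>Product distributions: Fubini and independence\<close>

text \<open>Supports are countable, so intersecting with them reduces arbitrary \<open>A\<close> and
  \<open>B\<close> to countable sets.\<close>

lemma measure_pair_pmf_Times:
  "measure_pmf.prob (pair_pmf M N) (A \<times> B) = measure_pmf.prob M A * measure_pmf.prob N B"
proof -
  have "measure_pmf.prob (pair_pmf M N) (A \<times> B)
      = measure_pmf.prob (pair_pmf M N) ((A \<times> B) \<inter> set_pmf (pair_pmf M N))"
    by (rule measure_Int_set_pmf[symmetric])
  also have "(A \<times> B) \<inter> set_pmf (pair_pmf M N) = (A \<inter> set_pmf M) \<times> (B \<inter> set_pmf N)"
    by auto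
  also have "measure_pmf.prob (pair_pmf M N) \<dots>
      = measure_pmf.prob M (A \<inter> set_pmf M) * measure_pmf.prob N (B \<inter> set_pmf N)"
    by (intro measure_pmf_prob_product) (auto intro: countable_subset[OF _ countable_set_pmf])
  finally show ?thesis
    by (simp add: measure_Int_set_pmf)
qed

text \<open>By Fubini, an event can be estimated conditionally on the first component, by a bound
  depending on \<open>x\<close>, and the bound then averaged.\<close>

lemma measure_pair_pmf_le:
  assumes "\<And>x. measure_pmf.prob N {y. (x, y) \<in> X} \<le> h x"
    and "integrable (measure_pmf M) h"
  shows "measure_pmf.prob (pair_pmf M N) X \<le> measure_pmf.expectation M h"
proof -
  have h0: "0 \<le> h x" for x
    using assms(1)[of x] by (meson measure_nonneg order_trans)
  have "ennreal (measure_pmf.prob (pair_pmf M N) X) = (\<integral>\<^sup>+z. indicator X z \<partial>pair_pmf M N)"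
    by (simp add: measure_pmf.emeasure_eq_measure)
  also have "\<dots> = (\<integral>\<^sup>+x. \<integral>\<^sup>+y. indicator X (x, y) \<partial>N \<partial>M)"
    by (rule nn_integral_pair_pmf')
  also have "\<dots> = (\<integral>\<^sup>+x. ennreal (measure_pmf.prob N {y. (x, y) \<in> X}) \<partial>M)"
  proof (intro nn_integral_cong)
    fix x
    have "(\<integral>\<^sup>+y. indicator X (x, y) \<partial>N) = (\<integral>\<^sup>+y. indicator {y. (x, y) \<in> X} y \<partial>N)"
      by (intro nn_integral_cong) (auto simp: indicator_def)
    then show "(\<integral>\<^sup>+y. indicator X (x, y) \<partial>N) = ennreal (measure_pmf.prob N {y. (x, y) \<in> X})"
      by (simp add: measure_pmf.emeasure_eq_measure)
  qed
  also have "\<dots> \<le> (\<integral>\<^sup>+x. ennreal (h x) \<partial>M)"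
    by (intro nn_integral_mono ennreal_leI assms)
  also have "\<dots> = ennreal (measure_pmf.expectation M h)"
    by (intro nn_integral_eq_integral assms) (simp add: h0)
  finally show ?thesis
    using h0 by (subst (asm) ennreal_le_iff) (auto intro: integral_nonneg_AE)
qed

text \<open>\<open>I\<close> splits into \<open>J\<close> and \<open>I - J\<close>, which contains
  \<open>K\<close>, so the two events become cylinders over the two factors of a pair of independent
  distributions.\<close>

lemma Pi_pmf_indep:
  assumes "finite I" "J \<subseteq> I" "K \<subseteq> I" "J \<inter> K = {}"
    and X: "\<And>x y. (\<And>i. i \<in> J \<Longrightarrow> x i = y i) \<Longrightarrow> x \<in> X \<longleftrightarrow> y \<in> X"
    and Y: "\<And>x y. (\<And>i. i \<in> K \<Longrightarrow> x i = y i) \<Longrightarrow> x \<in> Y \<longleftrightarrow> y \<in> Y"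
  shows "measure_pmf.prob (Pi_pmf I dflt p) (X \<inter> Y)
       = measure_pmf.prob (Pi_pmf I dflt p) X * measure_pmf.prob (Pi_pmf I dflt p) Y"
proof -
  define m where "m = (\<lambda>(f :: 'a \<Rightarrow> 'b, g) x. if x \<in> J then f x else g x)"
  define P where "P = pair_pmf (Pi_pmf J dflt p) (Pi_pmf (I - J) dflt p)"
  have "I = J \<union> (I - J)"
    using assms by auto
  moreover have "Pi_pmf (J \<union> (I - J)) dflt p = map_pmf m P"
    unfolding m_def P_def using assms by (intro Pi_pmf_union) (auto intro: finite_subset)
  ultimately have eq: "Pi_pmf I dflt p = map_pmf m P"
    by simp
  have mX: "m (f, g) \<in> X \<longleftrightarrow> f \<in> X" for f g
    by (rule X) (simp add: m_def)
  have mY: "m (f, g) \<in> Y \<longleftrightarrow> g \<in> Y" for f g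
    by (rule Y) (use assms(4) in \<open>auto simp: m_def\<close>)
  have "m -` (X \<inter> Y) = X \<times> Y" "m -` X = X \<times> UNIV" "m -` Y = UNIV \<times> Y"
    using mX mY by auto
  then show ?thesis
    by (simp add: eq P_def measure_pair_pmf_Times)
qed

section \<open>The symmetric local lemma\<close>

text \<open>The relation \<open>R\<close> is reflexive, so \<open>n\<close> counts the dependency degree plus one.\<close>

lemma (in prob_space) symmetric_local_lemma:
  assumes fin: "finite I"
    and ev: "\<And>i. i \<in> I \<Longrightarrow> B i \<in> events"
    and refl: "\<And>i. i \<in> I \<Longrightarrow> R i i"
    and deg: "\<And>i. i \<in> I \<Longrightarrow> card {j \<in> I. R i j} \<le> n"
    and indep: "\<And>i S. i \<in> I \<Longrightarrow> S \<subseteq> I \<Longrightarrow> (\<And>j. j \<in> S \<Longrightarrow> \<not> R i j) \<Longrightarrow>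
      prob (B i \<inter> {x \<in> space M. \<forall>j\<in>S. x \<notin> B j}) = prob (B i) * prob {x \<in> space M. \<forall>j\<in>S. x \<notin> B j}"
    and q: "\<And>i. i \<in> I \<Longrightarrow> prob (B i) \<le> q" "4 * q * real n \<le> 1"
  shows "\<exists>x\<in>space M. \<forall>i\<in>I. x \<notin> B i"
proof -
  define A where "A S = {x \<in> space M. \<forall>j\<in>S. x \<notin> B j}" for S
  have Aev: "A S \<in> events" if "S \<subseteq> I" for S
  proof -
    have "A S = space M - (\<Union>j\<in>S. B j)"
      by (auto simp: A_def)
    moreover have "(\<Union>j\<in>S. B j) \<in> events"
      using that finite_subset[OF that fin] ev by (intro sets.finite_UN) auto
    ultimately show ?thesis
      by simp
  qed
  \<comment> \<open>The conditional probability of \<open>B i\<close> given \<open>A S\<close> is at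
    most \<open>2 * q\<close>. Multiplied out, this can be proved before \<open>A S\<close> is known
    to have positive probability.\<close>
  have step: "prob (B i \<inter> A S) \<le> 2 * q * prob (A S)" if "S \<subseteq> I" "i \<in> I" for S i
    using that
  proof (induction "card S" arbitrary: S i rule: less_induct)
    case less
    have q0: "0 \<le> q"
      using q(1)[OF less.prems(2)] by (meson measure_nonneg order_trans)
    define S1 where "S1 = {j \<in> S. R i j}"
    define S2 where "S2 = S - S1"
    have S: "finite S" "S1 \<subseteq> S" "S2 \<subseteq> I" "S1 \<subseteq> I" "finite S1"
      using less.prems fin by (auto simp: S1_def S2_def intro: finite_subset)
    \<comment> \<open>Forgetting the events in \<open>S1\<close>, which may depend on
      \<open>B i\<close>, leaves a condition independent of \<open>B i\<close>.\<close>
    have "prob (B i \<inter> A S) \<le> prob (B i \<inter> A S2)"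
      using less.prems S ev by (intro finite_measure_mono sets.Int Aev) (auto simp: A_def S2_def)
    also have "\<dots> = prob (B i) * prob (A S2)"
      unfolding A_def using less.prems S by (intro indep) (auto simp: S1_def S2_def)
    also have "\<dots> \<le> q * prob (A S2)"
      using q less.prems by (intro mult_right_mono) auto
    finally have 1: "prob (B i \<inter> A S) \<le> q * prob (A S2)" .
    \<comment> \<open>A point that avoids all of \<open>S2\<close> either avoids all of
      \<open>S\<close> or lies in some \<open>B j\<close> with \<open>j\<close> in
      \<open>S1\<close>. By induction the sum is at most half of the left side and can be
      absorbed.\<close>
    have "prob (A S2) \<le> prob (A S) + (\<Sum>j\<in>S1. prob (B j \<inter> A S2))"
    proof -
      have "prob (A S2) \<le> prob (A S \<union> (\<Union>j\<in>S1. B j \<inter> A S2))"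
        using less.prems S ev
        by (intro finite_measure_mono sets.Un sets.finite_UN Aev sets.Int) (auto simp: A_def S2_def)
      also have "\<dots> \<le> prob (A S) + prob (\<Union>j\<in>S1. B j \<inter> A S2)"
        using less.prems S ev by (intro measure_Un_le sets.finite_UN Aev sets.Int) auto
      also have "prob (\<Union>j\<in>S1. B j \<inter> A S2) \<le> (\<Sum>j\<in>S1. prob (B j \<inter> A S2))"
        using less.prems S ev by (intro measure_UNION_le sets.Int Aev) auto
      finally show ?thesis by simp
    qed
    also have "(\<Sum>j\<in>S1. prob (B j \<inter> A S2)) \<le> (\<Sum>j\<in>S1. 2 * q * prob (A S2))"
    proof (rule sum_mono)
      fix j assume j: "j \<in> S1"
      then have "card S2 < card S"
        using S by (intro psubset_card_mono) (auto simp: S2_def)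
      then show "prob (B j \<inter> A S2) \<le> 2 * q * prob (A S2)"
        using less.hyps[of S2 j] S j by auto
    qed
    also have "\<dots> = (real (card S1) * (2 * q)) * prob (A S2)"
      by simp
    also have "\<dots> \<le> 1 / 2 * prob (A S2)"
    proof (intro mult_right_mono)
      have "card S1 \<le> card {j \<in> I. R i j}"
        using less.prems fin by (intro card_mono) (auto simp: S1_def)
      then have "real (card S1) \<le> real n"
        using deg[OF less.prems(2)] by linarith
      then have "real (card S1) * (2 * q) \<le> real n * (2 * q)"
        using q0 by (intro mult_right_mono) auto
      then show "real (card S1) * (2 * q) \<le> 1 / 2"
        using q(2) by (simp add: algebra_simps)
    qed simp
    finally have "prob (A S2) \<le> 2 * prob (A S)"
      by simp
    then have "q * prob (A S2) \<le> q * (2 * prob (A S))"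
      using q0 by (rule mult_left_mono)
    with 1 show ?case
      by simp
  qed
  have pos: "0 < prob (A S)" if "S \<subseteq> I" for S
    using finite_subset[OF that fin] that
  proof (induction S rule: finite_induct)
    case empty
    then show ?case
      by (simp add: A_def prob_space)
  next
    case (insert i S)
    then have iI: "i \<in> I" and SI: "S \<subseteq> I" by auto
    \<comment> \<open>Reflexivity makes \<open>n\<close> at least 1, so \<open>q <= 1 / 4\<close>
      and avoiding one more event keeps at least half of the probability.\<close>
    have "card {i} \<le> card {j \<in> I. R i j}"
      using fin refl iI by (intro card_mono) auto
    then have n1: "1 \<le> real n"
      using deg[OF iI] by simp
    have q0: "0 \<le> q"
      using q(1)[OF iI] by (meson measure_nonneg order_trans)
    have "4 * q * 1 \<le> 4 * q * real n"
      using n1 q0 by (intro mult_left_mono) auto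
    then have q4: "q \<le> 1 / 4"
      using q(2) by linarith
    have "prob (A S) = prob (A (insert i S)) + prob (B i \<inter> A S)"
    proof -
      have "A S = A (insert i S) \<union> (B i \<inter> A S)" "A (insert i S) \<inter> (B i \<inter> A S) = {}"
        by (auto simp: A_def)
      then show ?thesis
        using finite_measure_Union[of "A (insert i S)" "B i \<inter> A S"] ev iI insert.prems Aev SI
        by auto
    qed
    moreover have "2 * q * prob (A S) \<le> 1 / 2 * prob (A S)"
      using q4 by (intro mult_right_mono) auto
    ultimately show ?case
      using step[OF SI iI] insert.IH[OF SI] by linarith
  qed
  have "A I \<noteq> {}"
    using pos[of I] by auto
  then show ?thesis
    by (auto simp: A_def)
qed

section \<open>The failure probability of a single vertex\<close>

lemma exp_minus_one_le: "exp x - 1 \<le> 2 * x" if "0 \<le> x" "x \<le> 1" for x :: real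
proof -
  have "x\<^sup>2 \<le> x"
    using that by (simp add: power2_eq_square mult_left_le)
  then show ?thesis
    using exp_bound[OF that] by linarith
qed

text \<open>
  \<open>x (v, c)\<close> means that \<open>c\<close> is in the random set of \<open>v\<close>; \<open>E\<close> is the set of arcs leaving one vertex
  and \<open>h\<close> gives their heads.
\<close>

definition blocked_colors ::
    "'e set \<Rightarrow> ('e \<Rightarrow> 'v) \<Rightarrow> ('e \<Rightarrow> 'c \<times> 'c) \<Rightarrow> ('v \<times> 'c \<Rightarrow> bool) \<Rightarrow> 'c set" where
  "blocked_colors E h f x = {fst (f e) |e. e \<in> E \<and> x (h e, snd (f e))}"

lemma blocked_colors_cong:
  "(\<And>e. e \<in> E \<Longrightarrow> x (h e, snd (f e)) = y (h e, snd (f e))) \<Longrightarrow>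
   blocked_colors E h f x = blocked_colors E h f y"
  unfolding blocked_colors_def by metis

text \<open>Once the sets of the other vertices are fixed, the blocked colors are known, and failure
  means that the set of \<open>v\<close> contains none of the remaining ones. Averaging over
  \<open>J\<close> leaves an exponential moment of the number of blocked colors.\<close>

lemma prob_all_blocked_le:
  fixes U :: "'v set" and C :: "'c set" and E :: "'e set" and p :: real
  assumes fin: "finite U" "finite C" "finite E"
    and v: "v \<in> U" and h: "h ` E \<subseteq> U - {v}" and f: "f \<in> E \<rightarrow> C \<times> C"
    and d: "card E \<le> d"
    and r: "\<And>w c. card {c'. \<exists>e\<in>E. h e = w \<and> f e = (c', c)} \<le> r"
    and p: "0 \<le> p" "p \<le> 1" "p * real r \<le> 1"
  shows "measure_pmf.prob (Pi_pmf (U \<times> C) False (\<lambda>_. bernoulli_pmf p))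
           {x. \<forall>c\<in>C. x (v, c) \<longrightarrow> c \<in> blocked_colors E h f x}
         \<le> exp (2 * p\<^sup>2 * real d - p * real (card C))" (is "?lhs \<le> _")
proof -
  define J where "J = (U - {v}) \<times> C"
  define K where "K = {v} \<times> C"
  \<comment> \<open>These are the colors that \<open>v\<close> loses once \<open>z = (w, c)\<close>
    is chosen, that is, once \<open>c\<close> enters the set of \<open>w\<close>.\<close>
  define D where "D z = {c. \<exists>e\<in>E. (h e, snd (f e)) = z \<and> fst (f e) = c}" for z
  define b where "b = blocked_colors E h f"
  define m where "m = (\<lambda>(x, y) z. if z \<in> J then x z else (y z :: bool))"
  define PJ where "PJ = Pi_pmf J False (\<lambda>_. bernoulli_pmf p)"
  define PK where "PK = Pi_pmf K False (\<lambda>_. bernoulli_pmf p)"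
  define g where "g x = exp (- p * real (card C)) *
      (\<Prod>z\<in>J. exp (p * (if x z then real (card (D z)) else 0)))" for x
  have finJ: "finite J" and finK: "finite K"
    using fin by (auto simp: J_def K_def)
  have hJ: "(h e, snd (f e)) \<in> J" if "e \<in> E" for e
    using that h funcset_mem[OF f that] by (auto simp: J_def mem_Times_iff)
  have finD: "finite (D z)" for z
    using fin by (auto simp: D_def)
  have Dr: "card (D z) \<le> r" for z
  proof -
    have "D z = {c'. \<exists>e\<in>E. h e = fst z \<and> f e = (c', snd z)}"
      by (auto simp: D_def prod_eq_iff)
    then show ?thesis
      using r by simp
  qed
  have "Pi_pmf (J \<union> K) False (\<lambda>_. bernoulli_pmf p) = map_pmf m (pair_pmf PJ PK)"
    unfolding m_def PJ_def PK_def using finJ finK by (intro Pi_pmf_union) (auto simp: J_def K_def)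
  moreover have "J \<union> K = U \<times> C"
    using v by (auto simp: J_def K_def)
  ultimately have "?lhs = measure_pmf.prob (pair_pmf PJ PK)
      (m -` {x. \<forall>c\<in>C. x (v, c) \<longrightarrow> c \<in> b x})"
    by (simp add: b_def)
  also have "\<dots> \<le> measure_pmf.expectation PJ g"
  proof (rule measure_pair_pmf_le)
    fix x
    \<comment> \<open>No head equals \<open>v\<close>, so the blocked colors are determined by the
      coordinates in \<open>J\<close>.\<close>
    have bm: "b (m (x, y)) = b x" for y
      unfolding b_def using hJ by (intro blocked_colors_cong) (auto simp: m_def)
    have mv: "m (x, y) (v, c) = y (v, c)" for y c
      by (simp add: m_def J_def)
    \<comment> \<open>Given \<open>x\<close>, failure is a box: every color that is not blocked must
      be missing from the set of \<open>v\<close>, and blocked colors are unconstrained.\<close>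
    have "{y. (x, y) \<in> m -` {x. \<forall>c\<in>C. x (v, c) \<longrightarrow> c \<in> b x}}
        = Pi K (\<lambda>z. if snd z \<in> b x then UNIV else {False})"
      by (auto simp: bm mv K_def Pi_def)
    then have "measure_pmf.prob PK {y. (x, y) \<in> m -` {x. \<forall>c\<in>C. x (v, c) \<longrightarrow> c \<in> b x}}
        = (\<Prod>z\<in>K. measure_pmf.prob (bernoulli_pmf p) (if snd z \<in> b x then UNIV else {False}))"
      unfolding PK_def using finK by (simp add: measure_Pi_pmf_Pi)
    also have "\<dots> = (\<Prod>z\<in>K. if snd z \<in> b x then 1 else 1 - p)"
      using p by (intro prod.cong) (auto simp: measure_pmf_single)
    also have "\<dots> \<le> (\<Prod>z\<in>K. exp (- p + (if snd z \<in> b x then p else 0)))"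
      using p exp_ge_add_one_self[of "- p"] by (intro prod_mono) auto
    also have "\<dots> = exp (- p * real (card C) + p * real (card (C \<inter> b x)))"
    proof -
      have "(\<Sum>z\<in>K. (- p + (if snd z \<in> b x then p else 0)))
          = (\<Sum>c\<in>C. - p + (if c \<in> b x then p else 0))"
        unfolding K_def by (rule sum.reindex_bij_witness[of _ "\<lambda>c. (v, c)" snd]) auto
      also have "\<dots> = - p * real (card C) + p * real (card (C \<inter> b x))"
        using fin by (simp add: sum_subtractf sum.If_cases)
      finally show ?thesis
        using finK by (simp add: exp_sum[symmetric])
    qed
    also have "\<dots> \<le> g x"
    proof -
      \<comment> \<open>The union bound replaces the number of blocked colors by a sum over
        independent coordinates, so that its exponential factors.\<close>
      have "card (C \<inter> b x) \<le> card (\<Union>z\<in>{z\<in>J. x z}. D z)"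
        using finJ finD hJ by (intro card_mono) (auto simp: b_def blocked_colors_def D_def)
      also have "\<dots> \<le> (\<Sum>z\<in>{z\<in>J. x z}. card (D z))"
        using finJ by (intro card_UN_le) auto
      finally have "real (card (C \<inter> b x)) \<le> (\<Sum>z\<in>{z\<in>J. x z}. real (card (D z)))"
        by (simp flip: of_nat_sum)
      also have "\<dots> = (\<Sum>z\<in>J. if x z then real (card (D z)) else 0)"
        using finJ by (simp add: sum.inter_filter)
      finally have "p * real (card (C \<inter> b x)) \<le> p * (\<Sum>z\<in>J. if x z then real (card (D z)) else 0)"
        using p by (intro mult_left_mono)
      then show ?thesis
        using finJ by (simp add: g_def exp_sum[symmetric] sum_distrib_left flip: exp_add)
    qed
    finally show "measure_pmf.prob PK {y. (x, y) \<in> m -` {x. \<forall>c\<in>C. x (v, c) \<longrightarrow> c \<in> b x}} \<le> g x" .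
  next
    show "integrable (measure_pmf PJ) g"
      unfolding g_def PJ_def using finJ
      by (intro integrable_mult_right integrable_prod_Pi_pmf integrable_measure_pmf_finite) auto
  qed
  also have "\<dots> = exp (- p * real (card C)) *
      (\<Prod>z\<in>J. measure_pmf.expectation (bernoulli_pmf p)
        (\<lambda>y. exp (p * (if y then real (card (D z)) else 0))))"
    unfolding g_def PJ_def using finJ
    by (subst integral_mult_right_zero, subst expectation_prod_Pi_pmf)
       (auto intro: integrable_measure_pmf_finite)
  also have "\<dots> \<le> exp (- p * real (card C)) * (\<Prod>z\<in>J. exp (2 * p\<^sup>2 * real (card (D z))))"
  proof (intro mult_left_mono prod_mono conjI)
    fix z
    \<comment> \<open>Since \<open>p * r <= 1\<close>, the exponent stays where the exponential has
      a linear bound. The second factor \<open>p\<close> in the result is the probability that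
      \<open>z\<close> is chosen.\<close>
    have "p * real (card (D z)) \<le> p * real r"
      using Dr[of z] p by (intro mult_left_mono) auto
    then have "exp (p * real (card (D z))) - 1 \<le> 2 * (p * real (card (D z)))"
      using p by (intro exp_minus_one_le) auto
    then have "p * (exp (p * real (card (D z))) - 1) \<le> p * (2 * (p * real (card (D z))))"
      using p by (intro mult_left_mono)
    then have "p * exp (p * real (card (D z))) + (1 - p) \<le> 1 + 2 * p\<^sup>2 * real (card (D z))"
      by (simp add: algebra_simps power2_eq_square)
    also have "\<dots> \<le> exp (2 * p\<^sup>2 * real (card (D z)))"
      by (rule exp_ge_add_one_self)
    finally show "measure_pmf.expectation (bernoulli_pmf p)
        (\<lambda>y. exp (p * (if y then real (card (D z)) else 0))) \<le> exp (2 * p\<^sup>2 * real (card (D z)))"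
      using p by (simp add: mult.commute[of p "exp _"])
  qed (auto intro!: integral_nonneg_AE)
  also have "\<dots> = exp (2 * p\<^sup>2 * real (\<Sum>z\<in>J. card (D z)) - p * real (card C))"
    using finJ by (simp add: exp_sum[symmetric] sum_distrib_left flip: exp_add)
  also have "\<dots> \<le> exp (2 * p\<^sup>2 * real d - p * real (card C))"
  proof -
    \<comment> \<open>Each pair of a coordinate \<open>z\<close> and a color in \<open>D z\<close>
      comes from an arc, so the weights add up to at most the number of arcs.\<close>
    have "(\<Sum>z\<in>J. card (D z)) = card (Sigma J D)"
      using finJ finD by (simp add: card_SigmaI)
    also have "\<dots> \<le> card ((\<lambda>e. ((h e, snd (f e)), fst (f e))) ` E)"
      using fin by (intro card_mono) (auto simp: D_def image_iff)
    also have "\<dots> \<le> d"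
      using card_image_le[OF fin(3)] d order_trans by blast
    finally have "real (\<Sum>z\<in>J. card (D z)) \<le> real d"
      by (rule of_nat_mono)
    then show ?thesis
      by (simp add: mult_left_mono)
  qed
  finally show ?thesis .
qed

section \<open>Compactness for infinite graphs\<close>

text \<open>By Tychonoff, the colorings form a compact space. Each arc imposes a closed condition,
  and finitely many arcs have finitely many ends, so the finite intersection property
  applies.\<close>

lemma compactness_of_colorings:
  assumes C: "finite C"
    and ends: "\<And>e. e \<in> A \<Longrightarrow> s e \<in> V \<and> t e \<in> V"
    and fin: "\<And>W. finite W \<Longrightarrow> W \<subseteq> V \<Longrightarrow>
      \<exists>\<phi>\<in>V \<rightarrow> C. \<forall>e\<in>A. s e \<in> W \<longrightarrow> t e \<in> W \<longrightarrow> (\<phi> (s e), \<phi> (t e)) \<noteq> f e"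
  shows "\<exists>\<phi>\<in>V \<rightarrow> C. \<forall>e\<in>A. (\<phi> (s e), \<phi> (t e)) \<noteq> f e"
proof -
  define T where "T = product_topology (\<lambda>_. discrete_topology C) V"
  define K where "K e = {\<phi> \<in> topspace T. (\<phi> (s e), \<phi> (t e)) \<noteq> f e}" for e
  have top: "topspace T = V \<rightarrow>\<^sub>E C"
    by (simp add: T_def)
  have "compact_space T"
    using C by (simp add: T_def compact_space_product_topology compact_space_discrete_topology)
  moreover have "closedin T (K e)" if e: "e \<in> A" for e
  proof -
    \<comment> \<open>Intersecting with \<open>C\<close> covers colors \<open>c\<close> outside
      \<open>C\<close>, for which the set is empty.\<close>
    have op: "openin T {\<phi> \<in> topspace T. \<phi> v \<in> C \<inter> {c}}" if "v \<in> V" for v c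
      unfolding T_def using that
      by (intro openin_continuous_map_preimage[where Y = "discrete_topology C"]
            continuous_map_product_projection) auto
    have "openin T ({\<phi> \<in> topspace T. \<phi> (s e) \<in> C \<inter> {fst (f e)}}
        \<inter> {\<phi> \<in> topspace T. \<phi> (t e) \<in> C \<inter> {snd (f e)}})" (is "openin T ?N")
      using op ends[OF e] by blast
    moreover have "K e = topspace T - ?N"
      using ends[OF e] by (auto simp: K_def top prod_eq_iff dest: PiE_mem)
    ultimately show ?thesis
      by auto
  qed
  \<comment> \<open>\<open>topspace T\<close> is added because \<open>\<Inter>{} = UNIV\<close>.\<close>
  moreover have "\<Inter>\<F> \<noteq> {}" if \<F>: "finite \<F>" "\<F> \<subseteq> insert (topspace T) (K ` A)" for \<F>
  proof -
    have "finite (\<F> - {topspace T})" "\<F> - {topspace T} \<subseteq> K ` A"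
      using \<F> by auto
    from finite_subset_image[OF this]
    obtain F where F: "finite F" "F \<subseteq> A" "\<F> - {topspace T} = K ` F"
      by metis
    obtain \<phi> where \<phi>: "\<phi> \<in> V \<rightarrow> C"
        "\<forall>e\<in>A. s e \<in> s ` F \<union> t ` F \<longrightarrow> t e \<in> s ` F \<union> t ` F \<longrightarrow> (\<phi> (s e), \<phi> (t e)) \<noteq> f e"
    proof -
      have "finite (s ` F \<union> t ` F)" "s ` F \<union> t ` F \<subseteq> V"
        using F ends by auto
      from fin[OF this] show ?thesis
        using that by blast
    qed
    have top\<phi>: "restrict \<phi> V \<in> topspace T"
      using \<phi>(1) by (simp add: top restrict_PiE_iff Pi_iff)
    moreover have "restrict \<phi> V \<in> K e" if "e \<in> F" for e
      using that \<phi>(2) F(2) ends[of e] top\<phi> by (auto simp: K_def)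
    ultimately have "restrict \<phi> V \<in> \<Inter>\<F>"
      using F(3) by blast
    then show ?thesis
      by blast
  qed
  ultimately have "\<Inter>(insert (topspace T) (K ` A)) \<noteq> {}"
    unfolding compact_space_fip by (elim allE[of _ "insert (topspace T) (K ` A)"]) auto
  then obtain \<phi> where "\<phi> \<in> topspace T" "\<And>e. e \<in> A \<Longrightarrow> \<phi> \<in> K e"
    by auto
  then show ?thesis
    by (intro bexI[of _ \<phi>]) (auto simp: K_def top)
qed

section \<open>The local lemma on a finite set of vertices\<close>

text \<open>The exponent is at most \<open>- 4 * L\<close>, and \<open>exp L\<close> is
  \<open>exp 1 * X\<close> with \<open>X\<close> the argument of the logarithm. The failure
  probability is thus at most \<open>1 / (2 * X) ^ 4\<close>, while the dependency count is at most
  \<open>2 * X\<close>.\<close>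

lemma local_lemma_condition:
  fixes \<Delta> d r k :: nat
  assumes "1 \<le> r" "1 \<le> d" "1 \<le> \<Delta>" and L: "L = 1 + ln ((real d + 1) * real \<Delta>)"
    and k: "16 * real d * 2 ^ r * real r * L \<le> (real k)\<^sup>2"
    and p: "p = real k / (4 * real d * real r)"
  shows "4 * exp (2 * p\<^sup>2 * real d - p * real k) * real ((d + 1) * (\<Delta> + 1)) \<le> 1"
proof -
  define X where "X = (real d + 1) * real \<Delta>"
  have "2 * 1 \<le> (real d + 1) * real \<Delta>"
    using assms by (intro mult_mono) auto
  then have X: "2 \<le> X"
    by (simp add: X_def)
  have L1: "1 \<le> L"
    using X by (simp add: L X_def[symmetric])
  have dr: "0 < real d" "1 \<le> real r"
    using assms by auto
  \<comment> \<open>\<open>2 ^ r >= 2\<close> supplies the factor that turns 16 into 32.\<close>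
  have "16 * real d * 2 * real r * L \<le> 16 * real d * 2 ^ r * real r * L"
    using L1 dr assms(1) power_increasing[of 1 r "2::real"]
    by (intro mult_right_mono mult_left_mono) auto
  with k have k': "32 * real d * real r * L \<le> (real k)\<^sup>2"
    by (simp add: mult_ac)
  have "2 * p\<^sup>2 * real d - p * real k = (real k)\<^sup>2 / (8 * real d * (real r)\<^sup>2) - (real k)\<^sup>2 / (4 * real d * real r)"
    using dr by (simp add: p power2_eq_square field_simps)
  \<comment> \<open>Replacing \<open>r\<close> squared by \<open>r\<close> in the positive term
    makes it half of the negative one.\<close>
  also have "\<dots> \<le> (real k)\<^sup>2 / (8 * real d * real r) - (real k)\<^sup>2 / (4 * real d * real r)"
    using dr by (intro diff_right_mono divide_left_mono mult_left_mono) (auto simp: power2_eq_square)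
  also have "\<dots> = - ((real k)\<^sup>2 / (8 * real d * real r))"
    using dr by (simp add: field_simps)
  also have "\<dots> \<le> - (4 * L)"
    using dr k' by (simp add: field_simps)
  finally have "exp (2 * p\<^sup>2 * real d - p * real k) \<le> exp (- (4 * L))"
    by simp
  also have "\<dots> = 1 / exp L ^ 4"
    by (simp add: exp_minus exp_of_nat_mult[of 4 L, simplified] divide_inverse)
  also have "\<dots> \<le> 1 / (2 * X) ^ 4"
  proof (intro divide_left_mono power_mono)
    have "exp L = exp 1 * X"
      using X by (simp add: L X_def[symmetric] exp_add)
    moreover have "2 * X \<le> exp 1 * X"
      using X exp_ge_add_one_self[of 1] by (intro mult_right_mono) auto
    ultimately show "2 * X \<le> exp L"
      by simp
  qed (use X in auto)
  finally have 1: "exp (2 * p\<^sup>2 * real d - p * real k) \<le> 1 / (2 * X) ^ 4" .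
  have "real ((d + 1) * (\<Delta> + 1)) = (real d + 1) * (real \<Delta> + 1)"
    by (simp add: algebra_simps)
  also have "\<dots> \<le> (real d + 1) * (2 * real \<Delta>)"
    using assms by (intro mult_left_mono) auto
  finally have 2: "real ((d + 1) * (\<Delta> + 1)) \<le> 2 * X"
    by (simp add: X_def)
  have "4 * exp (2 * p\<^sup>2 * real d - p * real k) * real ((d + 1) * (\<Delta> + 1))
      \<le> 4 * (1 / (2 * X) ^ 4) * (2 * X)"
    using 1 2 X by (intro mult_mono) auto
  also have "\<dots> = 4 / (2 * X) ^ 3"
    using X by (simp add: power_numeral_reduce)
  also have "\<dots> \<le> 1"
    using X power_mono[of 4 "2 * X" 3] by simp
  finally show ?thesis .
qed

text \<open>The random sets live on \<open>U\<close>, which adds to \<open>W\<close> the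
  outneighbors of its vertices, because the bad event of \<open>v\<close> reads their sets as well.
  That event depends only on \<open>N v\<close>, so vertices with disjoint \<open>N\<close> have
  independent events.\<close>

lemma (in loopfree_digraph) finite_coloring:
  fixes f :: "'b \<Rightarrow> 'c \<times> 'c" and C :: "'c set" and \<Delta> d r k :: nat
  assumes fin: "\<And>v. v \<in> verts G \<Longrightarrow> finite (in_arcs G v)" "\<And>v. v \<in> verts G \<Longrightarrow> finite (out_arcs G v)"
    and deg: "\<And>v. v \<in> verts G \<Longrightarrow> card (in_arcs G v) \<le> \<Delta>"
    and out: "\<And>v. v \<in> verts G \<Longrightarrow> card (out_arcs G v) \<le> d"
    and restr: "\<And>v w c. v \<in> verts G \<Longrightarrow>
      card {c'. \<exists>e\<in>out_arcs G v. head G e = w \<and> f e = (c', c)} \<le> r"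
    and C: "finite C" "card C = k" "f \<in> arcs G \<rightarrow> C \<times> C"
    and pos: "1 \<le> r" "1 \<le> d" "1 \<le> \<Delta>" and kd: "k \<le> d"
    and k: "16 * real d * 2 ^ r * real r * (1 + ln ((real d + 1) * real \<Delta>)) \<le> (real k)\<^sup>2"
    and W: "finite W" "W \<subseteq> verts G"
  shows "\<exists>\<phi>\<in>W \<rightarrow> C. \<forall>e\<in>arcs G. tail G e \<in> W \<longrightarrow> head G e \<in> W \<longrightarrow>
           (\<phi> (tail G e), \<phi> (head G e)) \<noteq> f e"
proof -
  define N where "N v = insert v (head G ` out_arcs G v)" for v
  define U where "U = (\<Union>v\<in>W. N v)"
  \<comment> \<open>The exponent in \<open>q\<close> is smallest at \<open>k / (4 * d)\<close>.
    Dividing by \<open>r\<close> secures \<open>p * r <= 1\<close>, given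
    \<open>k <= d\<close>.\<close>
  define p where "p = real k / (4 * real d * real r)"
  define M where "M = Pi_pmf (U \<times> C) False (\<lambda>_. bernoulli_pmf p)"
  define b where "b v = blocked_colors (out_arcs G v) (head G) f" for v
  define B where "B v = {x. \<forall>c\<in>C. x (v, c) \<longrightarrow> c \<in> b v x}" for v
  define R where "R v u \<longleftrightarrow> N v \<inter> N u \<noteq> {}" for v u
  define q where "q = exp (2 * p\<^sup>2 * real d - p * real k)"
  have Nv: "finite (N v)" "N v \<subseteq> U" "N v \<subseteq> verts G" if "v \<in> W" for v
    using that W fin by (auto simp: N_def U_def)
  have finU: "finite U"
    using W Nv by (auto simp: U_def)
  have sndC: "snd (f e) \<in> C" if "e \<in> arcs G" for e
    using funcset_mem[OF C(3) that] by (auto simp: mem_Times_iff)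
  have B_cong: "x \<in> B v \<longleftrightarrow> y \<in> B v" if "\<And>z. z \<in> N v \<times> C \<Longrightarrow> x z = y z" for x y v
  proof -
    have "b v x = b v y"
      unfolding b_def using that sndC by (intro blocked_colors_cong) (auto simp: N_def)
    moreover have "x (v, c) = y (v, c)" if "c \<in> C" for c
      using that \<open>\<And>z. z \<in> N v \<times> C \<Longrightarrow> x z = y z\<close> by (auto simp: N_def)
    ultimately show ?thesis
      by (simp add: B_def)
  qed
  have "\<exists>x\<in>space M. \<forall>v\<in>W. x \<notin> B v"
  proof (rule measure_pmf.symmetric_local_lemma[where R = R and n = "(d + 1) * (\<Delta> + 1)" and q = q])
    show "R v v" for v
      by (auto simp: R_def N_def)
    show "card {u \<in> W. R v u} \<le> (d + 1) * (\<Delta> + 1)" if "v \<in> W" for v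
    proof -
      \<comment> \<open>These are the vertices \<open>u\<close> with \<open>w\<close> in
        \<open>N u\<close>: \<open>w\<close> itself and its inneighbors. Summing over the at most
        \<open>d + 1\<close> elements of \<open>N v\<close> bounds the dependencies.\<close>
      define P where "P w = insert w (tail G ` in_arcs G w)" for w
      have vV: "v \<in> verts G"
        using that W by auto
      have P: "finite (P w)" "card (P w) \<le> \<Delta> + 1" if "w \<in> N v" for w
      proof -
        have w: "w \<in> verts G"
          using that Nv(3)[OF \<open>v \<in> W\<close>] by auto
        show "finite (P w)"
          using fin(1)[OF w] by (simp add: P_def)
        have "card (P w) \<le> Suc (card (tail G ` in_arcs G w))"
          unfolding P_def by (rule card_insert_le_m1) auto
        then show "card (P w) \<le> \<Delta> + 1"
          using card_image_le[OF fin(1)[OF w], of "tail G"] deg[OF w] by linarith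
      qed
      have "{u \<in> W. R v u} \<subseteq> (\<Union>w\<in>N v. P w)"
        by (auto simp: R_def N_def P_def)
      then have "card {u \<in> W. R v u} \<le> card (\<Union>w\<in>N v. P w)"
        using Nv[OF that] P by (intro card_mono) auto
      also have "\<dots> \<le> (\<Sum>w\<in>N v. card (P w))"
        using Nv[OF that] by (intro card_UN_le)
      also have "\<dots> \<le> card (N v) * (\<Delta> + 1)"
        using sum_bounded_above[of "N v" "\<lambda>w. card (P w)" "\<Delta> + 1"] P by simp
      also have "\<dots> \<le> (d + 1) * (\<Delta> + 1)"
      proof (rule mult_right_mono)
        have "card (N v) \<le> Suc (card (head G ` out_arcs G v))"
          unfolding N_def by (rule card_insert_le_m1) auto
        then show "card (N v) \<le> d + 1"
          using card_image_le[OF fin(2)[OF vV], of "head G"] out[OF vV] by linarith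
      qed simp
      finally show ?thesis .
    qed
    show "measure_pmf.prob M (B v \<inter> {x \<in> space M. \<forall>u\<in>S. x \<notin> B u})
        = measure_pmf.prob M (B v) * measure_pmf.prob M {x \<in> space M. \<forall>u\<in>S. x \<notin> B u}"
      if "v \<in> W" "S \<subseteq> W" "\<And>u. u \<in> S \<Longrightarrow> \<not> R v u" for v S
      unfolding M_def
    proof (rule Pi_pmf_indep[where J = "N v \<times> C" and K = "(\<Union>u\<in>S. N u) \<times> C"])
      show "finite (U \<times> C)"
        using finU C by simp
      show "N v \<times> C \<subseteq> U \<times> C" "(\<Union>u\<in>S. N u) \<times> C \<subseteq> U \<times> C"
        using Nv(2) that by fast+
      show "N v \<times> C \<inter> (\<Union>u\<in>S. N u) \<times> C = {}"
        using that(3) by (auto simp: R_def)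
      show "x \<in> B v \<longleftrightarrow> y \<in> B v" if "\<And>i. i \<in> N v \<times> C \<Longrightarrow> x i = y i" for x y
        by (rule B_cong) (rule that)
      fix x y :: "'a \<times> 'c \<Rightarrow> bool"
      assume xy: "\<And>i. i \<in> (\<Union>u\<in>S. N u) \<times> C \<Longrightarrow> x i = y i"
      have "x \<in> B u \<longleftrightarrow> y \<in> B u" if "u \<in> S" for u
        using that by (intro B_cong xy) auto
      then show "x \<in> {x \<in> space (measure_pmf (Pi_pmf (U \<times> C) False (\<lambda>_. bernoulli_pmf p))). \<forall>u\<in>S. x \<notin> B u}
          \<longleftrightarrow> y \<in> {x \<in> space (measure_pmf (Pi_pmf (U \<times> C) False (\<lambda>_. bernoulli_pmf p))). \<forall>u\<in>S. x \<notin> B u}"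
        by simp
    qed
    show "measure_pmf.prob M (B v) \<le> q" if "v \<in> W" for v
    proof -
      have vV: "v \<in> verts G"
        using that W by auto
      have pr: "p * real r \<le> 1" "0 \<le> p"
        using pos kd by (auto simp: p_def field_simps)
      then have "p * 1 \<le> 1"
        using pos by (intro order_trans[OF mult_left_mono[of 1 "real r" p]]) auto
      then show ?thesis
        unfolding M_def B_def b_def q_def C(2)[symmetric] using that pr vV
        by (intro prob_all_blocked_le[where r = r] finU C fin out restr)
           (use Nv(2)[OF that] C(3) no_loops in \<open>auto simp: N_def Pi_iff\<close>)
    qed
    show "4 * q * real ((d + 1) * (\<Delta> + 1)) \<le> 1"
      unfolding q_def by (rule local_lemma_condition[OF pos refl k p_def])
  qed (use W in auto)
  then obtain x where x: "\<And>v. v \<in> W \<Longrightarrow> x \<notin> B v"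
    by auto
  then have "\<forall>v\<in>W. \<exists>c. c \<in> C \<and> x (v, c) \<and> c \<notin> b v x"
    by (auto simp: B_def)
  then obtain \<phi> where \<phi>: "\<And>v. v \<in> W \<Longrightarrow> \<phi> v \<in> C \<and> x (v, \<phi> v) \<and> \<phi> v \<notin> b v x"
    by metis
  \<comment> \<open>The color of the head lies in the random set of the head, so a violated conflict
    would block the color of the tail.\<close>
  have "(\<phi> (tail G e), \<phi> (head G e)) \<noteq> f e"
    if e: "e \<in> arcs G" "tail G e \<in> W" "head G e \<in> W" for e
  proof
    assume eq: "(\<phi> (tail G e), \<phi> (head G e)) = f e"
    have "fst (f e) \<in> b (tail G e) x"
      using e(1) \<phi>[OF e(3)] arg_cong[OF eq, of snd] by (auto simp: b_def blocked_colors_def)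
    then show False
      using \<phi>[OF e(2)] by (simp add: eq[symmetric])
  qed
  with \<phi> show ?thesis
    by (intro bexI[of _ \<phi>]) auto
qed

section \<open>Restrictiveness and the final case distinction\<close>

text \<open>Choosing one arc for each color \<open>c'\<close> discards repeated conflicts. The
  chosen arcs all go from \<open>v\<close> to \<open>w\<close>, so they are parallel and form a
  witness for \<open>restrictiveness_at\<close>.\<close>

lemma card_conflicts_le_restrictiveness:
  assumes v: "v \<in> verts G" and fin: "finite (out_arcs G v)"
  shows "enat (card {c'. \<exists>e\<in>out_arcs G v. head G e = w \<and> f e = (c', c)}) \<le> restrictiveness G f"
proof -
  define S where "S = {c'. \<exists>e\<in>out_arcs G v. head G e = w \<and> f e = (c', c)}"
  have "\<forall>c'\<in>S. \<exists>e. e \<in> out_arcs G v \<and> head G e = w \<and> f e = (c', c)"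
    by (auto simp: S_def)
  then obtain g where g: "\<And>c'. c' \<in> S \<Longrightarrow> g c' \<in> out_arcs G v \<and> head G (g c') = w \<and> f (g c') = (c', c)"
    by metis
  have "S \<subseteq> (fst \<circ> f) ` out_arcs G v"
    by (force simp: S_def)
  then have finS: "finite S"
    using fin finite_surj by blast
  have "inj_on g S"
    using g by (metis inj_onI fst_conv)
  then have "card (g ` S) = card S"
    by (rule card_image)
  moreover have "g ` S \<subseteq> out_arcs G v" "\<forall>e\<in>g ` S. \<forall>e'\<in>g ` S. parallel_arcs G e e'"
    using g by (auto simp: parallel_arcs_def in_out_arcs_conv)
  moreover have "f ` g ` S = S \<times> {c}"
    using g by (force simp: image_iff)
  ultimately have "enat (card S) \<le> restrictiveness_at G f v"
    unfolding restrictiveness_at_def using finS by (intro Sup_upper) blast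
  also have "\<dots> \<le> restrictiveness G f"
    unfolding restrictiveness_def using v by (rule SUP_upper)
  finally show ?thesis
    by (simp add: S_def)
qed

lemma ecard_le_enatD: "ecard A \<le> enat n \<Longrightarrow> finite A \<and> card A \<le> n"
  by (auto simp: ecard_def split: if_splits)

theorem theorem3p1:
  fixes G :: "('v, 'e) pre_digraph" and f :: "'e \<Rightarrow> 'c \<times> 'c" and C :: "'c set"
    and \<Delta> d r k :: nat
  assumes "loopfree_digraph G"
    and "max_degree G = enat \<Delta>"
    and "max_out_degree G \<le> enat d"
    and "finite C" and "C \<noteq> {}" and "card C = k"
    and "f \<in> arcs G \<rightarrow> C \<times> C"
    and "restrictiveness G f \<le> enat r"
    and "real k \<ge> sqrt (real d) * 2 powr (real r / 2 + 2) * sqrt (real r)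
           * sqrt (1 + ln ((real d + 1) * real \<Delta>))"
  shows "\<exists>\<phi>. single_conflict_coloring G f C \<phi>"
proof -
  interpret loopfree_digraph G by fact
  have deg: "finite (in_arcs G v \<union> out_arcs G v) \<and> card (in_arcs G v \<union> out_arcs G v) \<le> \<Delta>"
    if "v \<in> verts G" for v
  proof (rule ecard_le_enatD)
    show "ecard (in_arcs G v \<union> out_arcs G v) \<le> enat \<Delta>"
      unfolding assms(2)[symmetric] max_degree_def using that by (rule SUP_upper)
  qed
  then have fin: "finite (in_arcs G v)" "finite (out_arcs G v)" if "v \<in> verts G" for v
    using that by auto
  have in_le: "card (in_arcs G v) \<le> \<Delta>" and out_le: "card (out_arcs G v) \<le> \<Delta>" if "v \<in> verts G" for v
    using deg[OF that] card_mono[of "in_arcs G v \<union> out_arcs G v" "in_arcs G v"]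
      card_mono[of "in_arcs G v \<union> out_arcs G v" "out_arcs G v"] by auto
  have out: "card (out_arcs G v) \<le> d" if "v \<in> verts G" for v
  proof -
    have "ecard (out_arcs G v) \<le> max_out_degree G"
      unfolding max_out_degree_def using that by (rule SUP_upper)
    then show ?thesis
      using assms(3) ecard_le_enatD order_trans by blast
  qed
  have restr: "card {c'. \<exists>e\<in>out_arcs G v. head G e = w \<and> f e = (c', c)} \<le> r"
    if "v \<in> verts G" for v w c
    using order_trans[OF card_conflicts_le_restrictiveness[OF that fin(2)[OF that]] assms(8)] by simp
  \<comment> \<open>An arc forces \<open>d\<close>, \<open>\<Delta>\<close> and \<open>r\<close> to
    be at least 1, as the choice of \<open>p\<close> and the estimates require.\<close>
  consider "arcs G = {}" | "d < k" | e where "e \<in> arcs G" "k \<le> d"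
  proof (cases "arcs G = {}")
    case True
    then show ?thesis
      by (rule that(1))
  next
    case False
    then obtain e where "e \<in> arcs G"
      by blast
    then show ?thesis
      using that(2,3) by (cases "d < k") (simp_all add: not_less)
  qed
  then show ?thesis
  proof cases
    case 1
    obtain c where "c \<in> C"
      using \<open>C \<noteq> {}\<close> by blast
    with 1 show ?thesis
      by (intro exI[of _ "\<lambda>_. c"]) (simp add: single_conflict_coloring_def)
  next
    case 2
    have "C - (fst \<circ> f) ` out_arcs G v \<noteq> {}" if "v \<in> verts G" for v
    proof
      assume "C - (fst \<circ> f) ` out_arcs G v = {}"
      then have "card C \<le> card ((fst \<circ> f) ` out_arcs G v)"
        using fin(2)[OF that] by (intro card_mono) auto
      also have "\<dots> \<le> card (out_arcs G v)"
        using fin(2)[OF that] by (rule card_image_le)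
      finally show False
        using 2 assms(6) out[OF that] by simp
    qed
    then have "\<forall>v\<in>verts G. \<exists>c. c \<in> C - (fst \<circ> f) ` out_arcs G v"
      by blast
    from bchoice[OF this] obtain \<phi>
      where \<phi>: "\<And>v. v \<in> verts G \<Longrightarrow> \<phi> v \<in> C - (fst \<circ> f) ` out_arcs G v"
      by blast
    have "(\<phi> (tail G e), \<phi> (head G e)) \<noteq> f e" if "e \<in> arcs G" for e
    proof
      assume eq: "(\<phi> (tail G e), \<phi> (head G e)) = f e"
      have "fst (f e) \<in> (fst \<circ> f) ` out_arcs G (tail G e)"
        using that by simp
      then show False
        using \<phi>[OF tail_in_verts[OF that]] by (simp add: eq[symmetric])
    qed
    with \<phi> show ?thesis
      by (intro exI[of _ \<phi>]) (auto simp: single_conflict_coloring_def)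
  next
    case (3 e)
    define v where "v = tail G e"
    have v: "v \<in> verts G" and e: "e \<in> out_arcs G v"
      using 3 by (auto simp: v_def)
    have "card {e} \<le> card (out_arcs G v)"
      using e fin(2)[OF v] by (intro card_mono) auto
    then have pos: "1 \<le> d" "1 \<le> \<Delta>"
      using out[OF v] out_le[OF v] by auto
    \<comment> \<open>The conflict of \<open>e\<close> alone already gives restrictiveness at least
      1.\<close>
    have "card {fst (f e)} \<le> card {c'. \<exists>e'\<in>out_arcs G v. head G e' = head G e \<and> f e' = (c', snd (f e))}"
    proof (rule card_mono)
      have "{c'. \<exists>e'\<in>out_arcs G v. head G e' = head G e \<and> f e' = (c', snd (f e))} \<subseteq> (fst \<circ> f) ` out_arcs G v"
        by (force simp: image_iff)
      then show "finite {c'. \<exists>e'\<in>out_arcs G v. head G e' = head G e \<and> f e' = (c', snd (f e))}"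
        using fin(2)[OF v] finite_surj by blast
    qed (use e in auto)
    then have r1: "1 \<le> r"
      using restr[OF v, of "head G e" "snd (f e)"] by simp
    define L where "L = 1 + ln ((real d + 1) * real \<Delta>)"
    \<comment> \<open>The argument of the logarithm is at least 1, so \<open>L\<close> is
      nonnegative and squaring \<open>sqrt L\<close> gives back \<open>L\<close>.\<close>
    have "1 * 1 \<le> (real d + 1) * real \<Delta>"
      using pos by (intro mult_mono) auto
    then have L: "0 \<le> L"
      unfolding L_def by (intro add_nonneg_nonneg ln_ge_zero) auto
    have "(sqrt (real d) * 2 powr (real r / 2 + 2) * sqrt (real r) * sqrt L)\<^sup>2 \<le> (real k)\<^sup>2"
      using assms(9) L by (intro power_mono) (auto simp: L_def)
    moreover have "(2 powr (real r / 2 + 2))\<^sup>2 = 16 * (2::real) ^ r"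
      by (simp add: powr_add power_mult_distrib powr_powr flip: powr_realpow powr_numeral)
    ultimately have k: "16 * real d * 2 ^ r * real r * (1 + ln ((real d + 1) * real \<Delta>)) \<le> (real k)\<^sup>2"
      using L by (simp add: power_mult_distrib L_def mult_ac)
    have "\<exists>\<phi>\<in>verts G \<rightarrow> C. \<forall>e\<in>arcs G. (\<phi> (tail G e), \<phi> (head G e)) \<noteq> f e"
    proof (rule compactness_of_colorings)
      fix W assume W: "finite W" "W \<subseteq> verts G"
      obtain \<phi> where \<phi>: "\<phi> \<in> W \<rightarrow> C"
          "\<forall>e\<in>arcs G. tail G e \<in> W \<longrightarrow> head G e \<in> W \<longrightarrow> (\<phi> (tail G e), \<phi> (head G e)) \<noteq> f e"
        using finite_coloring[OF fin in_le out restr assms(4,6,7) r1 pos \<open>k \<le> d\<close> k W] by blast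
      \<comment> \<open>A default color outside \<open>W\<close> is harmless, since only arcs with
        both ends in \<open>W\<close> are constrained.\<close>
      obtain c where "c \<in> C"
        using \<open>C \<noteq> {}\<close> by blast
      with \<phi> show "\<exists>\<phi>\<in>verts G \<rightarrow> C. \<forall>e\<in>arcs G. tail G e \<in> W \<longrightarrow> head G e \<in> W \<longrightarrow>
          (\<phi> (tail G e), \<phi> (head G e)) \<noteq> f e"
        by (intro bexI[of _ "\<lambda>v. if v \<in> W then \<phi> v else c"]) auto
    qed (use assms(4) in auto)
    then show ?thesis
      by (auto simp: single_conflict_coloring_def)
  qed
qed

end
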